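(* Let $A$ be a commutative algebra with unit $1$ over $\mathbb{R}$ or $\mathbb{C}$, and let $x\in A$. If $y,z\in A$ are solutions of the quadratic equations $$xy^2-y+1=0,\qquad -xz^2-z+1=0,$$ then $w=\dfrac{y+z}{2}$ is a solution of the biquadratic equation $4x^2w^4-w^2+1=0$. *)

theory Defs
  imports Complex_Main "HOL-Algebra.Module" "HOL-Algebra.Algebraic_Closure_Type"
begin

(* The locale "algebra" of HOL-Algebra bundles associativity, commutativity and the unit of M
   (via "cring M").  It does not require the unit to differ from zero, so the zero algebra is
   included. *)

abbreviation real_field :: "real ring"
  where "real_field \<equiv> ring_of_type_algebra"

abbreviation complex_field :: "complex ring"
  where "complex_field \<equiv> ring_of_type_algebra"

end

theory Submission
  imports Defs
begin

text \<open>
  With $s = y + z$, $d = y - z$ and $q = xd$, the sum and the difference of the two equations read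
  $s = qs + 2$ and $2d = x(s^2 + d^2)$. The second gives $(xs)^2 = 2q - q^2 = 1 - (1 - q)^2$, hence
  $x^2 s^4 = s^2 - (s - qs)^2 = s^2 - 4$; substituting $s = 2w$ and dividing by 4 gives the claim.
\<close>

lemma (in cring) square_sum_of_opposite_quadratic_roots:
  assumes xyz [simp]: "x \<in> carrier R" "y \<in> carrier R" "z \<in> carrier R"
    and y: "x \<otimes> (y \<otimes> y) \<ominus> y \<oplus> \<one> = \<zero>"
    and z: "(\<ominus> x) \<otimes> (z \<otimes> z) \<ominus> z \<oplus> \<one> = \<zero>"
  defines "s \<equiv> y \<oplus> z"
  shows "s \<otimes> s = (x \<otimes> s) \<otimes> (x \<otimes> s) \<otimes> (s \<otimes> s) \<oplus> (\<one> \<oplus> \<one>) \<otimes> (\<one> \<oplus> \<one>)"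
proof -
  define d where "d = y \<ominus> z"
  define q where "q = x \<otimes> d"
  have c: "s \<in> carrier R" "d \<in> carrier R" "q \<in> carrier R"
    using xyz by (simp_all add: s_def d_def q_def)
  \<comment> \<open>Each quadratic equation is solved for its linear term. The unknown recurs on the
    right, so these equations would loop as rewrite rules and are applied with \<open>metis\<close>
    below; the same holds for fact \<open>1\<close>.\<close>
  have y': "y = x \<otimes> (y \<otimes> y) \<oplus> \<one>"
  proof -
    have "y = (x \<otimes> (y \<otimes> y) \<ominus> y \<oplus> \<one>) \<oplus> y" by (simp add: y)
    also have "\<dots> = x \<otimes> (y \<otimes> y) \<oplus> \<one>" using xyz c by algebra
    finally show ?thesis .
  qed
  have z': "z = \<one> \<ominus> x \<otimes> (z \<otimes> z)"
  proof -
    have "z = ((\<ominus> x) \<otimes> (z \<otimes> z) \<ominus> z \<oplus> \<one>) \<oplus> z" by (simp add: z)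
    also have "\<dots> = \<one> \<ominus> x \<otimes> (z \<otimes> z)" using xyz c by algebra
    finally show ?thesis .
  qed
  \<comment> \<open>In the sum the quadratic terms leave x(y^2 - z^2) = x(y - z)(y + z), which is
    \<open>q\<close> times \<open>s\<close>.\<close>
  have "s = (x \<otimes> (y \<otimes> y) \<oplus> \<one>) \<oplus> (\<one> \<ominus> x \<otimes> (z \<otimes> z))"
    unfolding s_def using y' z' by metis
  also have "\<dots> = q \<otimes> s \<oplus> (\<one> \<oplus> \<one>)"
    unfolding s_def d_def q_def using xyz c by algebra
  finally have 1: "s = q \<otimes> s \<oplus> (\<one> \<oplus> \<one>)" .
  have "d = (x \<otimes> (y \<otimes> y) \<oplus> \<one>) \<ominus> (\<one> \<ominus> x \<otimes> (z \<otimes> z))"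
    unfolding d_def using y' z' by metis
  also have "\<dots> = x \<otimes> (y \<otimes> y) \<oplus> x \<otimes> (z \<otimes> z)"
    using xyz c by algebra
  \<comment> \<open>Doubling makes the identity 2(y^2 + z^2) = s^2 + d^2 available without division:
    2 need not be invertible in a commutative ring.\<close>
  finally have "d \<oplus> d = (x \<otimes> (y \<otimes> y) \<oplus> x \<otimes> (z \<otimes> z)) \<oplus> (x \<otimes> (y \<otimes> y) \<oplus> x \<otimes> (z \<otimes> z))"
    by simp
  also have "\<dots> = x \<otimes> (s \<otimes> s) \<oplus> x \<otimes> (d \<otimes> d)"
    unfolding s_def d_def using xyz c by algebra
  finally have 2: "d \<oplus> d = x \<otimes> (s \<otimes> s) \<oplus> x \<otimes> (d \<otimes> d)" .
  \<comment> \<open>This is fact \<open>2\<close> multiplied by \<open>x\<close>: the term x(xd^2)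
    is q^2, and x(d + d) is q + q.\<close>
  have "(x \<otimes> s) \<otimes> (x \<otimes> s) = x \<otimes> (x \<otimes> (s \<otimes> s) \<oplus> x \<otimes> (d \<otimes> d)) \<ominus> q \<otimes> q"
    unfolding q_def using xyz c by algebra
  also have "\<dots> = q \<oplus> q \<ominus> q \<otimes> q"
    unfolding 2[symmetric] q_def using xyz c by algebra
  finally have 3: "(x \<otimes> s) \<otimes> (x \<otimes> s) = q \<oplus> q \<ominus> q \<otimes> q" .
  have "s \<ominus> q \<otimes> s = q \<otimes> s \<oplus> (\<one> \<oplus> \<one>) \<ominus> q \<otimes> s"
    using 1 by metis
  also have "\<dots> = \<one> \<oplus> \<one>"
    using xyz c by algebra
  finally have 4: "\<one> \<oplus> \<one> = s \<ominus> q \<otimes> s" by simp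
  \<comment> \<open>Fact \<open>4\<close> writes 2 as (1 - q)s, so the constant 4 becomes (1 - q)^2
    s^2. What remains is a polynomial identity in \<open>q\<close> and \<open>s\<close>, namely (2q
    - q^2) + (1 - q)^2 = 1 multiplied by s^2.\<close>
  show ?thesis
    unfolding 3 4 using xyz c by algebra
qed

text \<open>Characteristic 0 supplies the scalars 1/2 and 1/4, and the class
  \<open>field_char_0\<close> covers real and complex scalars at once. The preceding lemma gives
  four times the desired equation, and scaling by 1/4 finishes.\<close>

lemma half_sum_of_opposite_quadratic_roots:
  fixes A :: "('k::field_char_0, 'a, 'm) module_scheme"
  assumes "algebra ring_of_type_algebra A"
    and [simp]: "x \<in> carrier A" "y \<in> carrier A" "z \<in> carrier A"
    and y: "x \<otimes>\<^bsub>A\<^esub> y [^]\<^bsub>A\<^esub> (2::nat) \<ominus>\<^bsub>A\<^esub> y \<oplus>\<^bsub>A\<^esub> \<one>\<^bsub>A\<^esub> = \<zero>\<^bsub>A\<^esub>"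
    and z: "(\<ominus>\<^bsub>A\<^esub> x) \<otimes>\<^bsub>A\<^esub> z [^]\<^bsub>A\<^esub> (2::nat) \<ominus>\<^bsub>A\<^esub> z \<oplus>\<^bsub>A\<^esub> \<one>\<^bsub>A\<^esub> = \<zero>\<^bsub>A\<^esub>"
    and w: "w = (1/2) \<odot>\<^bsub>A\<^esub> (y \<oplus>\<^bsub>A\<^esub> z)"
  shows "4 \<odot>\<^bsub>A\<^esub> (x [^]\<^bsub>A\<^esub> (2::nat) \<otimes>\<^bsub>A\<^esub> w [^]\<^bsub>A\<^esub> (4::nat))
    \<ominus>\<^bsub>A\<^esub> w [^]\<^bsub>A\<^esub> (2::nat) \<oplus>\<^bsub>A\<^esub> \<one>\<^bsub>A\<^esub> = \<zero>\<^bsub>A\<^esub>"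
proof -
  interpret algebra "ring_of_type_algebra :: 'k ring" A by fact
  define s where "s = y \<oplus>\<^bsub>A\<^esub> z"
  have [simp]: "s \<in> carrier A" by (simp add: s_def)
  \<comment> \<open>Every element of the type is an admissible scalar, so carrier conditions on
    scalars disappear. The facts \<open>add\<close>, \<open>mul\<close> and \<open>one\<close>
    restate the module laws with the arithmetic of the type, so that the simplifier can compute with
    numerals.\<close>
  have K: "carrier (ring_of_type_algebra :: 'k ring) = UNIV"
    by (simp add: ring_of_type_algebra_def)
  have sc [simp]: "a \<odot>\<^bsub>A\<^esub> u \<in> carrier A" if "u \<in> carrier A" for a u
    using that by (simp add: K)
  have add: "(a + b) \<odot>\<^bsub>A\<^esub> u = a \<odot>\<^bsub>A\<^esub> u \<oplus>\<^bsub>A\<^esub> b \<odot>\<^bsub>A\<^esub> u" if "u \<in> carrier A" for a b u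
    using smult_l_distr[of a b u] that by (simp add: ring_of_type_algebra_def)
  have mul: "a \<odot>\<^bsub>A\<^esub> (b \<odot>\<^bsub>A\<^esub> u) = (a * b) \<odot>\<^bsub>A\<^esub> u" if "u \<in> carrier A" for a b u
    using smult_assoc1[of a b u] that by (simp add: ring_of_type_algebra_def)
  have one [simp]: "1 \<odot>\<^bsub>A\<^esub> u = u" if "u \<in> carrier A" for u
    using smult_one[of u] that by (simp add: ring_of_type_algebra_def)
  have l: "(a \<odot>\<^bsub>A\<^esub> u) \<otimes>\<^bsub>A\<^esub> v = a \<odot>\<^bsub>A\<^esub> (u \<otimes>\<^bsub>A\<^esub> v)"
    if "u \<in> carrier A" "v \<in> carrier A" for a u v
    using smult_assoc2 that by (simp add: K)
  have r: "u \<otimes>\<^bsub>A\<^esub> (a \<odot>\<^bsub>A\<^esub> v) = a \<odot>\<^bsub>A\<^esub> (u \<otimes>\<^bsub>A\<^esub> v)"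
    if "u \<in> carrier A" "v \<in> carrier A" for a u v
    using l[of v u a] that by (simp add: m_comm)
  have two: "\<one>\<^bsub>A\<^esub> \<oplus>\<^bsub>A\<^esub> \<one>\<^bsub>A\<^esub> = 2 \<odot>\<^bsub>A\<^esub> \<one>\<^bsub>A\<^esub>"
    using add[of "\<one>\<^bsub>A\<^esub>" 1 1] by simp
  \<comment> \<open>The ring lemma expresses 4 through sums of the unit; here it becomes a scalar
    multiple, which 1/4 can cancel.\<close>
  have four: "(\<one>\<^bsub>A\<^esub> \<oplus>\<^bsub>A\<^esub> \<one>\<^bsub>A\<^esub>) \<otimes>\<^bsub>A\<^esub> (\<one>\<^bsub>A\<^esub> \<oplus>\<^bsub>A\<^esub> \<one>\<^bsub>A\<^esub>) = 4 \<odot>\<^bsub>A\<^esub> \<one>\<^bsub>A\<^esub>"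
    by (simp add: two l mul)
  have ww: "w [^]\<^bsub>A\<^esub> (2::nat) = (1/4) \<odot>\<^bsub>A\<^esub> (s \<otimes>\<^bsub>A\<^esub> s)"
    by (simp add: numeral_eq_Suc w l r mul flip: s_def)
  define P where "P = x \<otimes>\<^bsub>A\<^esub> s \<otimes>\<^bsub>A\<^esub> (x \<otimes>\<^bsub>A\<^esub> s) \<otimes>\<^bsub>A\<^esub> (s \<otimes>\<^bsub>A\<^esub> s)"
  have [simp]: "P \<in> carrier A" by (simp add: P_def)
  \<comment> \<open>The coefficient is 4 * (1/2)^4 = 1/4, because \<open>w\<close> is half of
    \<open>s\<close> and \<open>P\<close> is x^2 s^4.\<close>
  have xw: "4 \<odot>\<^bsub>A\<^esub> (x [^]\<^bsub>A\<^esub> (2::nat) \<otimes>\<^bsub>A\<^esub> w [^]\<^bsub>A\<^esub> (4::nat)) = (1/4) \<odot>\<^bsub>A\<^esub> P"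
    by (simp add: numeral_eq_Suc w l r mul m_ac P_def flip: s_def)
  have "s \<otimes>\<^bsub>A\<^esub> s = P \<oplus>\<^bsub>A\<^esub> 4 \<odot>\<^bsub>A\<^esub> \<one>\<^bsub>A\<^esub>"
    using cring.square_sum_of_opposite_quadratic_roots[OF M_cring, of x y z] y z
    by (simp add: numeral_2_eq_2 s_def P_def four)
  then have "w [^]\<^bsub>A\<^esub> (2::nat) = (1/4) \<odot>\<^bsub>A\<^esub> P \<oplus>\<^bsub>A\<^esub> \<one>\<^bsub>A\<^esub>"
    by (simp add: ww smult_r_distr K mul)
  \<comment> \<open>Both x^2 w^4 and w^2 are now expressed through \<open>P\<close>, and the claim
    reads P/4 - (P/4 + 1) + 1 = 0.\<close>
  then show ?thesis
    unfolding xw by (simp add: minus_eq minus_add r_neg a_ac)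
qed

theorem theorem2p1:
  fixes A :: "(real, 'a, 'm) module_scheme"
    and B :: "(complex, 'b, 'n) module_scheme"
  shows
    "(algebra real_field A \<longrightarrow>
       (\<forall>x\<in>carrier A. \<forall>y\<in>carrier A. \<forall>z\<in>carrier A. \<forall>w.
          x \<otimes>\<^bsub>A\<^esub> y [^]\<^bsub>A\<^esub> (2::nat) \<ominus>\<^bsub>A\<^esub> y \<oplus>\<^bsub>A\<^esub> \<one>\<^bsub>A\<^esub> = \<zero>\<^bsub>A\<^esub> \<longrightarrow>
          (\<ominus>\<^bsub>A\<^esub> x) \<otimes>\<^bsub>A\<^esub> z [^]\<^bsub>A\<^esub> (2::nat) \<ominus>\<^bsub>A\<^esub> z \<oplus>\<^bsub>A\<^esub> \<one>\<^bsub>A\<^esub> = \<zero>\<^bsub>A\<^esub> \<longrightarrow>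
          w = (1/2) \<odot>\<^bsub>A\<^esub> (y \<oplus>\<^bsub>A\<^esub> z) \<longrightarrow>
          4 \<odot>\<^bsub>A\<^esub> (x [^]\<^bsub>A\<^esub> (2::nat) \<otimes>\<^bsub>A\<^esub> w [^]\<^bsub>A\<^esub> (4::nat))
            \<ominus>\<^bsub>A\<^esub> w [^]\<^bsub>A\<^esub> (2::nat) \<oplus>\<^bsub>A\<^esub> \<one>\<^bsub>A\<^esub> = \<zero>\<^bsub>A\<^esub>)) \<and>
     (algebra complex_field B \<longrightarrow>
       (\<forall>x\<in>carrier B. \<forall>y\<in>carrier B. \<forall>z\<in>carrier B. \<forall>w.
          x \<otimes>\<^bsub>B\<^esub> y [^]\<^bsub>B\<^esub> (2::nat) \<ominus>\<^bsub>B\<^esub> y \<oplus>\<^bsub>B\<^esub> \<one>\<^bsub>B\<^esub> = \<zero>\<^bsub>B\<^esub> \<longrightarrow>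
          (\<ominus>\<^bsub>B\<^esub> x) \<otimes>\<^bsub>B\<^esub> z [^]\<^bsub>B\<^esub> (2::nat) \<ominus>\<^bsub>B\<^esub> z \<oplus>\<^bsub>B\<^esub> \<one>\<^bsub>B\<^esub> = \<zero>\<^bsub>B\<^esub> \<longrightarrow>
          w = (1/2) \<odot>\<^bsub>B\<^esub> (y \<oplus>\<^bsub>B\<^esub> z) \<longrightarrow>
          4 \<odot>\<^bsub>B\<^esub> (x [^]\<^bsub>B\<^esub> (2::nat) \<otimes>\<^bsub>B\<^esub> w [^]\<^bsub>B\<^esub> (4::nat))
            \<ominus>\<^bsub>B\<^esub> w [^]\<^bsub>B\<^esub> (2::nat) \<oplus>\<^bsub>B\<^esub> \<one>\<^bsub>B\<^esub> = \<zero>\<^bsub>B\<^esub>))"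
  by (intro conjI impI ballI allI; rule half_sum_of_opposite_quadratic_roots; assumption)

end
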